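(* Let $n,k,p,N\in\mathbb{N}$ with $k\le n$. Consider the mass spring damper system $$M\ddot z(t)+D\dot z(t)+Kz(t)=\Gamma u(t),\quad z(0)=z_0,\qquad y(t)=\Gamma^{*}\dot z(t),$$ with $z(t)\in\mathbb{C}^n$, $M=M^{*}>0$, $K=K^{*}>0$, $D=D^{*}\ge 0$ in $\mathbb{C}^{n\times n}$ and $\Gamma\in\mathbb{C}^{n\times p}$. Let interpolation frequencies $s_1,\ldots,s_N\in\mathbb{C}$ and tangent directions $\mu_1,\ldots,\mu_N\in\mathbb{C}^p$ be given. Consider the following two reduced models, based on the same set of $\mu_m$'s and $s_m$'s. (i) Second-order Arnoldi model: let $V_0\in\mathbb{C}^{n\times k}$ be such that $V_0^{*}V_0=I_k$ and $(s_m^2M+s_mD+K)^{-1}\Gamma\mu_m\in\mathrm{ran}(V_0)$ for $m=1,\ldots,N$, and let $$M_{red}\ddot z_{red}(t)+D_{red}\dot z_{red}(t)+K_{red}z_{red}(t)=\Gamma_{red}u(t),\quad z_{red}(0)=V_0^{*}z_0,\qquad y_{red}(t)=\Gamma_{red}^{*}\dot z_{red}(t),$$ with $M_{red}=V_0^{*}MV_0$, $D_{red}=V_0^{*}DV_0$, $K_{red}=V_0^{*}KV_0$, $\Gamma_{red}=V_0^{*}\Gamma$. (ii) Symplectic port-Hamiltonian model: with $\Psi_1,\Psi_2,\Phi_1,\Phi_2\in\mathbb{C}^{n\times k}$ given by the symplectic-pH construction described in the context, let $$\hat M_{red}\ddot{\hat z}_{red}(t)+\hat D_{red}\dot{\hat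 z}_{red}(t)+\hat K_{red}\hat z_{red}(t)=\hat\Gamma_{red}u(t),\quad \hat z_{red}(0)=\Psi_2^{*}z_0,\qquad \hat y_{red}(t)=\hat\Gamma_{red}^{*}\dot{\hat z}_{red}(t),$$ with $\hat M_{red}=(\Psi_1^{*}M^{-1}\Psi_1)^{-1}$, $\hat K_{red}=\Phi_1^{*}K\Phi_1$, $\hat D_{red}=\Psi_2^{*}D\Psi_2$, $\hat\Gamma_{red}=\Psi_2^{*}\Gamma$. Then there exists a unitary matrix $\Theta\in\mathbb{C}^{k\times k}$ such that $z_{red}(t)=\Theta\hat z_{red}(t)$.
   Context: $^{*}$ denotes the conjugate transpose and $\mathrm{ran}$ the range (column space). For Hermitian matrices, $>0$ and $\ge0$ mean positive definite and positive semi-definite. $I_n$ is the $n\times n$ identity matrix. The inverses $(s_m^2M+s_mD+K)^{-1}$ are understood to exist. With state $x=\begin{bmatrix} z \\ M \dot z \end{bmatrix}$ the mass spring damper system is the port-Hamiltonian system $\dot x=(J_{2n}-R)\mathcal{H}x+Bu$, $y=B^{*}\mathcal{H}x$ with $$J_{2n}=\begin{bmatrix} 0 & I_n \\ -I_n & 0 \end{bmatrix},\quad R=\begin{bmatrix} 0 & 0 \\ 0 & D \end{bmatrix},\quad \mathcal{H}=\begin{bmatrix} K & 0 \\ 0 & M^{-1} \end{bmatrix},\quad B=\begin{bmatrix} 0 \\ \Gamma \end{bmatrix}.$$ Symplectic-pH construction (for this system, with reduced structure matrix $\begin{bmatrix} 0 & I_k \\ -I_k & 0 \end{bmatrix}$):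 take $V_1,V_2\in\mathbb{C}^{2n\times k}$ such that $(s_mI_{2n}-(J_{2n}-R)\mathcal{H})^{-1}B\mu_m\in\mathrm{ran}(V_1)$ for $m=1,\ldots,N$ and $\mathrm{ran}(\mathcal{H}V_1)\subseteq\mathrm{ran}(V_2)$. Partition $V_1=\begin{bmatrix} V_{11} \\ V_{12} \end{bmatrix}$ and $V_2=\begin{bmatrix} V_{21} \\ V_{22} \end{bmatrix}$ with blocks in $\mathbb{C}^{n\times k}$, and set $$\Psi_2=\mathrm{orth}(V_{22}),\quad \Psi_1=V_{12}(\Psi_2^{*}V_{12})^{-1},\quad \Phi_2=V_{21}(\Psi_2^{*}V_{21})^{-1},\quad \Phi_1=V_{11}(\Phi_2^{*}V_{11})^{-1},$$ where $\mathrm{orth}(V_{22})\in\mathbb{C}^{n\times k}$ is a matrix whose columns form an orthonormal basis of $\mathrm{ran}(V_{22})$, of the same dimension, obtained from the singular value decomposition. The inverses in this construction are assumed to exist.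
   Formalization: It is additionally assumed that the vectors (s_m^2 M+s_m D+K)^{-1}Γμ_m span a k-dimensional space (otherwise the claim is false), and the unspecified initial velocities are taken as V_0^*v_0 and Ψ_2^*v_0 for a common arbitrary v_0. *)

theory Defs
  imports "HOL-Analysis.Analysis"
begin

definition conj_transpose :: "complex^'n^'m \<Rightarrow> complex^'m^'n" where
  "conj_transpose A = (\<chi> i j. cnj (A $ j $ i))"

definition hermitian :: "complex^'n^'n \<Rightarrow> bool" where
  "hermitian A \<longleftrightarrow> conj_transpose A = A"

definition unitary :: "complex^'n^'n \<Rightarrow> bool" where
  "unitary U \<longleftrightarrow> conj_transpose U ** U = mat 1 \<and> U ** conj_transpose U = mat 1"

definition cinner :: "complex^'n \<Rightarrow> complex^'n \<Rightarrow> complex" where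
  "cinner x y = (\<Sum>i\<in>UNIV. cnj (x $ i) * y $ i)"

(* The quadratic form of a Hermitian matrix is real-valued, so Re discards nothing below. *)

definition pos_def :: "complex^'n^'n \<Rightarrow> bool" where
  "pos_def A \<longleftrightarrow> hermitian A \<and> (\<forall>x. x \<noteq> 0 \<longrightarrow> 0 < Re (cinner x (A *v x)))"

definition pos_semidef :: "complex^'n^'n \<Rightarrow> bool" where
  "pos_semidef A \<longleftrightarrow> hermitian A \<and> (\<forall>x. 0 \<le> Re (cinner x (A *v x)))"

definition col_space :: "complex^'k^'n \<Rightarrow> (complex^'n) set" where
  "col_space A = range (\<lambda>x. A *v x)"

(* Q is an admissible value of orth(A) for a matrix A of full column rank: the left factor
   Q of a thin singular value decomposition A = Q S W^* whose columns form an orthonormal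
   basis of the range of A.  A predicate, because Q is not unique.  It cannot hold
   if A is column-rank deficient. *)
definition is_orth :: "complex^'k^'n \<Rightarrow> complex^'k^'n \<Rightarrow> bool" where
  "is_orth A Q \<longleftrightarrow>
     conj_transpose Q ** Q = mat 1 \<and> col_space Q = col_space A \<and>
     (\<exists>(\<sigma> :: 'k \<Rightarrow> real) (W :: complex^'k^'k).
        (\<forall>i. 0 \<le> \<sigma> i) \<and> unitary W \<and>
        A = Q ** (\<chi> i j. if i = j then complex_of_real (\<sigma> i) else 0) ** conj_transpose W)"

(* Block matrices are indexed by a sum type: Inl selects the first block, Inr the second. *)

definition block_mat ::
  "complex^'c^'a \<Rightarrow> complex^'d^'a \<Rightarrow> complex^'c^'b \<Rightarrow> complex^'d^'b
     \<Rightarrow> complex^('c + 'd)^('a + 'b)" where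
  "block_mat A B C D = (\<chi> i j.
     (case i of
        Inl a \<Rightarrow> (case j of Inl c \<Rightarrow> A $ a $ c | Inr d \<Rightarrow> B $ a $ d)
      | Inr b \<Rightarrow> (case j of Inl c \<Rightarrow> C $ b $ c | Inr d \<Rightarrow> D $ b $ d)))"

definition block_col :: "complex^'k^'a \<Rightarrow> complex^'k^'b \<Rightarrow> complex^'k^('a + 'b)" where
  "block_col A B = (\<chi> i. (case i of Inl a \<Rightarrow> A $ a | Inr b \<Rightarrow> B $ b))"

definition upper_block :: "complex^'k^('a::finite + 'b::finite) \<Rightarrow> complex^'k^'a" where
  "upper_block V = (\<chi> i. V $ Inl i)"

definition lower_block :: "complex^'k^('a::finite + 'b::finite) \<Rightarrow> complex^'k^'b" where
  "lower_block V = (\<chi> i. V $ Inr i)"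

definition pH_J :: "complex^('n::finite + 'n)^('n::finite + 'n)" where
  "pH_J = block_mat 0 (mat 1) (- mat 1) 0"

definition pH_R :: "complex^'n^'n \<Rightarrow> complex^('n::finite + 'n)^('n::finite + 'n)" where
  "pH_R D = block_mat 0 0 0 D"

definition pH_H :: "complex^'n^'n \<Rightarrow> complex^'n^'n \<Rightarrow> complex^('n::finite + 'n)^('n::finite + 'n)" where
  "pH_H M K = block_mat K 0 0 (matrix_inv M)"

definition pH_B :: "complex^'p^'n \<Rightarrow> complex^'p^('n::finite + 'n)" where
  "pH_B \<Gamma> = block_col 0 \<Gamma>"

(* s^2 M + s D + K; the matrix mat c is c times the identity. *)
definition quad_pencil ::
  "complex^'n^'n \<Rightarrow> complex^'n^'n \<Rightarrow> complex^'n^'n \<Rightarrow> complex \<Rightarrow> complex^'n^'n" where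
  "quad_pencil M D K s = mat (s\<^sup>2) ** M + mat s ** D + K"

definition symplectic_pH_construction ::
  "complex^'n^'n \<Rightarrow> complex^'n^'n \<Rightarrow> complex^'n^'n \<Rightarrow> complex^'p^'n
     \<Rightarrow> nat \<Rightarrow> (nat \<Rightarrow> complex) \<Rightarrow> (nat \<Rightarrow> complex^'p)
     \<Rightarrow> complex^'k^('n::finite + 'n) \<Rightarrow> complex^'k^('n::finite + 'n)
     \<Rightarrow> complex^'k^'n \<Rightarrow> complex^'k^'n \<Rightarrow> complex^'k^'n \<Rightarrow> complex^'k^'n \<Rightarrow> bool" where
  "symplectic_pH_construction M D K \<Gamma> N s \<mu> V1 V2 \<Psi>1 \<Psi>2 \<Phi>1 \<Phi>2 \<longleftrightarrow>
     (\<forall>m\<in>{1..N}. matrix_inv (mat (s m) - (pH_J - pH_R D) ** pH_H M K) *v (pH_B \<Gamma> *v \<mu> m)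
                   \<in> col_space V1) \<and>
     col_space (pH_H M K ** V1) \<subseteq> col_space V2 \<and>
     is_orth (lower_block V2) \<Psi>2 \<and>
     invertible (conj_transpose \<Psi>2 ** lower_block V1) \<and>
     \<Psi>1 = lower_block V1 ** matrix_inv (conj_transpose \<Psi>2 ** lower_block V1) \<and>
     invertible (conj_transpose \<Psi>2 ** upper_block V2) \<and>
     \<Phi>2 = upper_block V2 ** matrix_inv (conj_transpose \<Psi>2 ** upper_block V2) \<and>
     invertible (conj_transpose \<Phi>2 ** upper_block V1) \<and>
     \<Phi>1 = upper_block V1 ** matrix_inv (conj_transpose \<Phi>2 ** upper_block V1)"

(* On the time interval [0, oo), z is a classical solution of
     M z'' + D z' + K z = \<Gamma> u,  z(0) = z0,  z'(0) = v0,   with output  y = \<Gamma>^* z'. *)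
definition second_order_model ::
  "complex^'n^'n \<Rightarrow> complex^'n^'n \<Rightarrow> complex^'n^'n \<Rightarrow> complex^'p^'n
     \<Rightarrow> complex^'n \<Rightarrow> complex^'n
     \<Rightarrow> (real \<Rightarrow> complex^'p) \<Rightarrow> (real \<Rightarrow> complex^'n) \<Rightarrow> (real \<Rightarrow> complex^'p) \<Rightarrow> bool" where
  "second_order_model M D K \<Gamma> z0 v0 u z y \<longleftrightarrow>
     (\<exists>z' z''.
        z 0 = z0 \<and> z' 0 = v0 \<and>
        (\<forall>t\<ge>0. (z has_vector_derivative z' t) (at t within {0..}) \<and>
               (z' has_vector_derivative z'' t) (at t within {0..}) \<and>
               M *v z'' t + D *v z' t + K *v z t = \<Gamma> *v u t \<and>
               y t = conj_transpose \<Gamma> *v z' t))"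

end

theory Submission
  imports Defs
begin

text \<open>
  With \<open>w\<^sub>m = (s\<^sub>m\<^sup>2 M + s\<^sub>m D + K)\<^sup>-\<^sup>1 \<Gamma> \<mu>\<^sub>m\<close>, block elimination shows that the
  interpolation vectors of the port-Hamiltonian system are the columns \<open>(w\<^sub>m, s\<^sub>m M w\<^sub>m)\<close>.
  As the \<open>w\<^sub>m\<close> span a space of dimension \<open>k\<close>, these columns span the range of \<open>V1\<close>, so the
  upper block of \<open>V1\<close> and \<open>V0\<close> have the same range. The lower
  block \<open>V12\<close> satisfies \<open>M\<^sup>-\<^sup>1 V12 = \<Psi>2 Z\<close> with \<open>Z\<close> invertible, so the range of \<open>\<Psi>2\<close> lies in the span of the
  \<open>w\<^sub>m\<close>. Hence \<open>\<Psi>2 = V0 \<Theta>\<close> with \<open>\<Theta>\<close> unitary. The construction collapses to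
  \<open>\<Psi>1 = M \<Psi>2 (\<Psi>2\<^sup>* M \<Psi>2)\<^sup>-\<^sup>1\<close> and \<open>\<Phi>1 = \<Psi>2\<close>, so the two reduced models differ by the
  change of variables \<open>\<Theta>\<close>. The claim then follows from uniqueness of the initial value problem,
  which is a consequence of the decay of the energy \<open>z'\<^sup>* M z' + z\<^sup>* K z\<close>.
\<close>

subsection \<open>Matrix algebra\<close>

lemma matrix_inv_inverse:
  assumes "invertible A"
  shows "A ** matrix_inv A = mat 1" "matrix_inv A ** A = mat 1"
  using someI_ex[OF assms[unfolded invertible_def]] by (auto simp: matrix_inv_def)

lemma matrix_inv_eqI:
  fixes A B :: "'a::field^'n^'n"
  assumes "A ** B = mat 1"
  shows "matrix_inv A = B"
proof -
  have "invertible A"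
    using assms invertible_right_inverse by blast
  then have "matrix_inv A ** (A ** B) = B"
    by (simp add: matrix_mul_assoc matrix_inv_inverse)
  then show ?thesis
    by (simp add: assms)
qed

lemma invertible_mult_rightD:
  fixes A B :: "'a::field^'n^'n"
  assumes "invertible (A ** B)"
  shows "invertible B"
proof -
  obtain C where "C ** (A ** B) = mat 1"
    using assms invertible_left_inverse by blast
  then have "(C ** A) ** B = mat 1"
    by (simp add: matrix_mul_assoc)
  then show ?thesis
    using invertible_left_inverse by blast
qed

lemma mat_mult_vec [simp]: "mat c *v x = c *s x"
  by (simp add: vec_eq_iff matrix_vector_mult_def mat_def if_distrib[where f="\<lambda>a. a * _"]
      cong: if_cong)

lemma matrix_vector_mult_uminus [simp]: "(- A) *v x = - (A *v x)"
  for A :: "'a::ring_1^'n^'m"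
  by (simp add: vec_eq_iff matrix_vector_mult_def sum_negf)

lemma conj_transpose_mult: "conj_transpose (A ** B) = conj_transpose B ** conj_transpose A"
  by (simp add: conj_transpose_def matrix_matrix_mult_def vec_eq_iff mult.commute)

lemma conj_transpose_conj_transpose [simp]: "conj_transpose (conj_transpose A) = A"
  by (simp add: conj_transpose_def vec_eq_iff)

lemma conj_transpose_mat_1 [simp]: "conj_transpose (mat 1) = mat 1"
  by (simp add: conj_transpose_def vec_eq_iff mat_def)

lemma cinner_matrix_vector: "cinner x (A *v y) = cinner (conj_transpose A *v x) y"
proof -
  have "cinner x (A *v y) = (\<Sum>i\<in>UNIV. \<Sum>j\<in>UNIV. cnj (x $ i) * (A $ i $ j * y $ j))"
    by (simp add: cinner_def matrix_vector_mult_def sum_distrib_left)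
  also have "\<dots> = (\<Sum>j\<in>UNIV. \<Sum>i\<in>UNIV. cnj (x $ i) * (A $ i $ j * y $ j))"
    by (rule sum.swap)
  also have "\<dots> = cinner (conj_transpose A *v x) y"
    by (simp add: cinner_def matrix_vector_mult_def conj_transpose_def sum_distrib_left sum_distrib_right mult_ac)
  finally show ?thesis .
qed

text \<open>Lets positivity of Hermitian forms, and later the energy, be treated with the real inner
  product and its calculus.\<close>

lemma Re_cinner: "Re (cinner x y) = inner x y"
  by (simp add: cinner_def inner_vec_def inner_complex_def)

lemma inner_matrix_vector: "inner x (A *v y) = inner (conj_transpose A *v x) y"
  for A :: "complex^'n^'m"
  by (metis Re_cinner cinner_matrix_vector)

lemma inner_hermitian: "hermitian A \<Longrightarrow> inner x (A *v y) = inner y (A *v x)"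
  by (metis hermitian_def inner_matrix_vector inner_commute)

lemma pos_def_inner_pos: "pos_def A \<Longrightarrow> x \<noteq> 0 \<Longrightarrow> 0 < inner x (A *v x)"
  by (simp add: pos_def_def Re_cinner)

lemma pos_def_inner_nonneg: "pos_def A \<Longrightarrow> 0 \<le> inner x (A *v x)"
  by (cases "x = 0") (auto dest: pos_def_inner_pos less_imp_le)

lemma pos_def_invertible:
  assumes "pos_def A"
  shows "invertible A"
proof -
  have "x = 0" if "A *v x = 0" for x
    using pos_def_inner_pos[OF assms, of x] that by auto
  then show ?thesis
    using invertible_left_inverse matrix_left_invertible_ker by blast
qed

lemma conj_transpose_congruence:
  "conj_transpose (conj_transpose V ** A ** V) = conj_transpose V ** conj_transpose A ** V"
  by (simp add: conj_transpose_mult matrix_mul_assoc)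

lemma inner_congruence:
  "inner x ((conj_transpose V ** A ** V) *v x) = inner (V *v x) (A *v (V *v x))"
  for A :: "complex^'n^'n"
  by (metis inner_matrix_vector conj_transpose_conj_transpose matrix_vector_mul_assoc)

lemma orthonormal_mult_eq_0:
  fixes V :: "complex^'k^'n"
  assumes "conj_transpose V ** V = mat 1" "V *v x = 0"
  shows "x = 0"
  by (metis assms matrix_vector_mul_assoc matrix_vector_mul_lid matrix_vector_mult_0_right)

text \<open>Orthonormal columns make \<open>V\<close> injective, so the form at \<open>x\<close> is
  the form of \<open>A\<close> at the nonzero vector \<open>V *v x\<close>.\<close>

lemma pos_def_congruence:
  fixes V :: "complex^'k^'n"
  assumes "pos_def A" "conj_transpose V ** V = mat 1"
  shows "pos_def (conj_transpose V ** A ** V)"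
  using assms orthonormal_mult_eq_0[OF assms(2)]
  by (auto simp: pos_def_def hermitian_def conj_transpose_congruence Re_cinner inner_congruence)

lemma pos_semidef_congruence:
  "pos_semidef A \<Longrightarrow> pos_semidef (conj_transpose V ** A ** V)"
  by (simp add: pos_semidef_def hermitian_def conj_transpose_congruence Re_cinner inner_congruence)

subsection \<open>Column spaces\<close>

lemma subspace_col_space: "vec.subspace (col_space A)"
  unfolding col_space_def by (intro vec.subspace_image vec.subspace_UNIV)

lemma dim_col_space_le: "vec.dim (col_space (A :: complex^'k^'n)) \<le> CARD('k)"
  using vec.dim_image_le[OF matrix_vector_mul_linear_gen, of A UNIV]
  by (simp add: col_space_def vec_dim_card del: vec.dim_UNIV)

text \<open>A range of a matrix with \<open>CARD('k)\<close> columns has at most that dimension, so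
  vectors inside it that reach this dimension already span it. This is how the interpolation data
  determine the ranges of \<open>V0\<close> and \<open>V1\<close>.\<close>

lemma col_space_eq_span:
  fixes A :: "complex^'k^'n"
  assumes "S \<subseteq> col_space A" "vec.dim S \<ge> CARD('k)"
  shows "col_space A = vec.span S"
proof -
  have "vec.span S \<subseteq> col_space A"
    using assms(1) subspace_col_space by (rule vec.span_minimal)
  moreover have "vec.dim (col_space A) \<le> vec.dim (vec.span S)"
    using dim_col_space_le[of A] assms(2) by (simp only: vec.dim_span)
  ultimately show ?thesis
    using vec.subspace_dim_equal[OF vec.subspace_span subspace_col_space] by metis
qed

lemma col_space_mult_subset: "col_space (A ** B) \<subseteq> col_space A"
  by (auto simp: col_space_def matrix_vector_mul_assoc[symmetric])

lemma col_space_subset_factor: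
  fixes A :: "complex^'k^'n" and B :: "complex^'l^'n"
  assumes "col_space A \<subseteq> col_space B"
  obtains C where "A = B ** C"
proof -
  \<comment> \<open>\<open>A *v axis j 1\<close> is column \<open>j\<close> of \<open>A\<close>; its
    coefficients over the columns of \<open>B\<close> become column \<open>j\<close> of the
    factor.\<close>
  have "\<exists>c. A *v axis j 1 = B *v c" for j
    using assms unfolding col_space_def by blast
  then obtain c where c: "\<And>j. A *v axis j 1 = B *v c j"
    by metis
  have "A = B ** (\<chi> i j. c j $ i)"
  proof -
    have "A $ i $ j = (B ** (\<chi> i j. c j $ i)) $ i $ j" for i j
    proof -
      have "A $ i $ j = (A *v axis j 1) $ i"
      by (simp add: matrix_vector_mult_def axis_def if_distrib cong: if_cong)
    also have "\<dots> = (B ** (\<chi> i j. c j $ i)) $ i $ j"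
      unfolding c by (simp add: matrix_vector_mult_def matrix_matrix_mult_def)
      finally show ?thesis .
    qed
    then show ?thesis
      by (simp add: vec_eq_iff)
  qed
  then show ?thesis ..
qed

text \<open>Substituting \<open>W = V ** \<Theta>\<close> into the orthonormality of
  \<open>W\<close> leaves \<open>\<Theta>\<close> a left-invertible square matrix, whose left
  inverse is two-sided.\<close>

lemma orthonormal_bases_unitary:
  fixes V W :: "complex^'k^'n"
  assumes V: "conj_transpose V ** V = mat 1" and W: "conj_transpose W ** W = mat 1"
    and sub: "col_space W \<subseteq> col_space V"
  obtains \<Theta> where "unitary \<Theta>" "W = V ** \<Theta>"
proof -
  obtain \<Theta> where \<Theta>: "W = V ** \<Theta>"
    using sub by (rule col_space_subset_factor)
  have "conj_transpose W ** W = conj_transpose \<Theta> ** (conj_transpose V ** V) ** \<Theta>"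
    by (simp add: \<Theta> conj_transpose_mult matrix_mul_assoc)
  then have "conj_transpose \<Theta> ** \<Theta> = mat 1"
    by (simp add: V W)
  then have "unitary \<Theta>"
    using matrix_left_right_inverse unfolding unitary_def by blast
  then show ?thesis
    using \<Theta> that by blast
qed

subsection \<open>Block vectors and the resolvent of the port-Hamiltonian system\<close>

text \<open>Vector counterparts of the matrix blocks, so that block identities can be checked by
  action on vectors.\<close>

definition upper_vec :: "'a^('m::finite + 'n::finite) \<Rightarrow> 'a^'m" where
  "upper_vec x = (\<chi> i. x $ Inl i)"

definition lower_vec :: "'a^('m::finite + 'n::finite) \<Rightarrow> 'a^'n" where
  "lower_vec x = (\<chi> i. x $ Inr i)"

definition block_vec :: "'a^'m \<Rightarrow> 'a^'n \<Rightarrow> 'a^('m::finite + 'n::finite)" where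
  "block_vec a b = (\<chi> i. case i of Inl i \<Rightarrow> a $ i | Inr i \<Rightarrow> b $ i)"

lemma block_vec_simps [simp]:
  "upper_vec (block_vec a b) = a" "lower_vec (block_vec a b) = b"
  by (simp_all add: upper_vec_def lower_vec_def block_vec_def vec_eq_iff)

lemma block_vec_eq_iff: "x = y \<longleftrightarrow> upper_vec x = upper_vec y \<and> lower_vec x = lower_vec y"
  by (auto simp: vec_eq_iff upper_vec_def lower_vec_def split_sum_all)

lemma block_vec_linear [simp]:
  fixes x y :: "complex^('m::finite + 'n::finite)"
  shows "upper_vec (x + y) = upper_vec x + upper_vec y" "lower_vec (x + y) = lower_vec x + lower_vec y"
    "upper_vec (x - y) = upper_vec x - upper_vec y" "lower_vec (x - y) = lower_vec x - lower_vec y"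
    "upper_vec (c *s x) = c *s upper_vec x" "lower_vec (c *s x) = c *s lower_vec x"
    "upper_vec (0 :: complex^('m::finite + 'n::finite)) = 0"
    "lower_vec (0 :: complex^('m::finite + 'n::finite)) = 0"
  by (simp_all add: upper_vec_def lower_vec_def vec_eq_iff)

lemma linear_upper_vec:
  "Vector_Spaces.linear (*s) (*s) (upper_vec :: complex^('m::finite + 'n::finite) \<Rightarrow> _)"
  by unfold_locales (simp_all add: vec.scale_right_distrib vec.scale_left_distrib)

lemma linear_lower_vec:
  "Vector_Spaces.linear (*s) (*s) (lower_vec :: complex^('m::finite + 'n::finite) \<Rightarrow> _)"
  by unfold_locales (simp_all add: vec.scale_right_distrib vec.scale_left_distrib)

lemma sum_UNIV_Plus:
  "sum f (UNIV :: ('a::finite + 'b::finite) set) = (\<Sum>i\<in>UNIV. f (Inl i)) + (\<Sum>i\<in>UNIV. f (Inr i))"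
  by (simp add: UNIV_Plus_UNIV[symmetric] sum.Plus del: UNIV_Plus_UNIV)

lemma block_mat_mult_vec:
  "block_mat A B C D *v x =
     block_vec (A *v upper_vec x + B *v lower_vec x) (C *v upper_vec x + D *v lower_vec x)"
  by (simp add: vec_eq_iff split_sum_all block_mat_def block_vec_def upper_vec_def lower_vec_def
      matrix_vector_mult_def sum_UNIV_Plus)

lemma pH_B_mult_vec: "pH_B \<Gamma> *v x = block_vec 0 (\<Gamma> *v x)"
  by (simp add: vec_eq_iff split_sum_all pH_B_def block_col_def block_vec_def
      matrix_vector_mult_def)

lemma upper_block_mult_vec: "upper_block V *v x = upper_vec (V *v x)"
  by (simp add: vec_eq_iff upper_block_def upper_vec_def matrix_vector_mult_def)

lemma lower_block_mult_vec: "lower_block V *v x = lower_vec (V *v x)"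
  by (simp add: vec_eq_iff lower_block_def lower_vec_def matrix_vector_mult_def)

lemma col_space_upper_block: "col_space (upper_block V) = upper_vec ` col_space V"
  by (simp add: col_space_def upper_block_mult_vec image_image)

lemma col_space_lower_block: "col_space (lower_block V) = lower_vec ` col_space V"
  by (simp add: col_space_def lower_block_mult_vec image_image)

lemma pH_pencil_mult_vec:
  "(mat s - (pH_J - pH_R D) ** pH_H M K) *v x =
     block_vec (s *s upper_vec x - matrix_inv M *v lower_vec x)
       (s *s lower_vec x + K *v upper_vec x + D *v (matrix_inv M *v lower_vec x))"
  by (simp add: matrix_vector_mult_diff_rdistrib matrix_vector_mul_assoc[symmetric] pH_J_def
      pH_R_def pH_H_def block_mat_mult_vec block_vec_eq_iff algebra_simps)

lemma quad_pencil_mult_vec: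
  "quad_pencil M D K s *v x = s\<^sup>2 *s (M *v x) + s *s (D *v x) + K *v x"
  by (simp add: quad_pencil_def matrix_vector_mult_add_rdistrib matrix_vector_mul_assoc[symmetric])

text \<open>The first block row of the pencil ties the lower block of a solution to
  \<open>s *s (M *v a)\<close>, with \<open>a\<close> its upper block; the second row then becomes
  the quadratic pencil acting on \<open>a\<close>.\<close>

lemma pH_resolvent:
  fixes M D K :: "complex^'n^'n" and b :: "complex^'n"
  assumes M: "invertible M" and P: "invertible (quad_pencil M D K s)"
  defines "w \<equiv> matrix_inv (quad_pencil M D K s) *v b"
  shows "matrix_inv (mat s - (pH_J - pH_R D) ** pH_H M K) *v block_vec 0 b
           = block_vec w (s *s (M *v w))"
proof -
  let ?G = "mat s - (pH_J - pH_R D) ** pH_H M K"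
  have MM: "M *v (matrix_inv M *v x) = x" "matrix_inv M *v (M *v x) = x" for x
    by (simp_all add: matrix_vector_mul_assoc matrix_inv_inverse[OF M])
  \<comment> \<open>Elimination on a kernel vector: invertibility of the quadratic pencil carries
    over to the first-order pencil.\<close>
  have "x = 0" if "?G *v x = 0" for x
  proof -
    have eqs: "s *s upper_vec x - matrix_inv M *v lower_vec x = 0"
      "s *s lower_vec x + K *v upper_vec x + D *v (matrix_inv M *v lower_vec x) = 0"
      using that by (simp_all add: pH_pencil_mult_vec block_vec_eq_iff)
    have low: "lower_vec x = s *s (M *v upper_vec x)"
      using eqs(1) MM(1)[of "lower_vec x"] by (metis eq_iff_diff_eq_0 vector_scalar_commute)
    have "quad_pencil M D K s *v upper_vec x = 0"
      using eqs(2) unfolding low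
      by (simp add: quad_pencil_mult_vec vector_scalar_commute MM vec.scale_scale
          power2_eq_square ac_simps)
    then have "upper_vec x = 0"
      by (metis P invertible_left_inverse matrix_left_invertible_ker)
    then show ?thesis
      using low by (simp add: block_vec_eq_iff)
  qed
  then have "invertible ?G"
    using invertible_left_inverse matrix_left_invertible_ker by blast
  moreover have "?G *v block_vec w (s *s (M *v w)) = block_vec 0 b"
  proof -
    have "quad_pencil M D K s *v w = b"
      by (simp add: w_def matrix_vector_mul_assoc matrix_inv_inverse[OF P])
    then show ?thesis
      by (simp add: pH_pencil_mult_vec block_vec_eq_iff vector_scalar_commute MM
          quad_pencil_mult_vec power2_eq_square vec.scale_scale ac_simps)
  qed
  ultimately show ?thesis
    by (metis matrix_inv_inverse(2) matrix_vector_mul_assoc matrix_vector_mul_lid)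
qed

section \<open>Collapse of the symplectic construction\<close>

lemma col_space_matrix_mult: "col_space (A ** B) = (*v) A ` col_space B"
  by (simp add: col_space_def matrix_vector_mul_assoc[symmetric] image_image)

lemma pH_H_mult_vec:
  "pH_H M K *v x = block_vec (K *v upper_vec x) (matrix_inv M *v lower_vec x)"
  by (simp add: pH_H_def block_mat_mult_vec)

text \<open>The purely algebraic half: these conclusions make the mass, damping and stiffness
  matrices of the symplectic model \<open>\<Theta>\<close>-congruent to those of the Arnoldi
  model.\<close>

lemma symplectic_pH_reduction:
  fixes M D K :: "complex^'n^'n" and V0 :: "complex^'k^'n"
  assumes M: "pos_def M"
    and pencil: "\<forall>m\<in>{1..N}. invertible (quad_pencil M D K (s m))"
    and span_dim: "vec.dim ((\<lambda>m. matrix_inv (quad_pencil M D K (s m)) *v (\<Gamma> *v \<mu> m)) ` {1..N}) = CARD('k)"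
    and V0: "conj_transpose V0 ** V0 = mat 1"
    and V0_ran: "\<forall>m\<in>{1..N}. matrix_inv (quad_pencil M D K (s m)) *v (\<Gamma> *v \<mu> m) \<in> col_space V0"
    and symplectic: "symplectic_pH_construction M D K \<Gamma> N s \<mu> V1 V2 \<Psi>1 \<Psi>2 \<Phi>1 \<Phi>2"
  obtains \<Theta> where "unitary \<Theta>" "\<Psi>2 = V0 ** \<Theta>" "\<Phi>1 = \<Psi>2"
    "matrix_inv (conj_transpose \<Psi>1 ** matrix_inv M ** \<Psi>1) = conj_transpose \<Psi>2 ** M ** \<Psi>2"
proof -
  define w where "w m = matrix_inv (quad_pencil M D K (s m)) *v (\<Gamma> *v \<mu> m)" for m
  define v where "v m = block_vec (w m) (s m *s (M *v w m))" for m
  define V11 where "V11 = upper_block V1"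
  define V12 where "V12 = lower_block V1"
  define V21 where "V21 = upper_block V2"
  define V22 where "V22 = lower_block V2"
  have Minv: "invertible M"
    using M by (rule pos_def_invertible)
  have Mher: "conj_transpose M = M"
    using M by (simp add: pos_def_def hermitian_def)
  note S = symplectic[unfolded symplectic_pH_construction_def, folded V11_def V12_def V21_def V22_def]
  have orth: "conj_transpose \<Psi>2 ** \<Psi>2 = mat 1" "col_space \<Psi>2 = col_space V22"
    using S by (auto simp: is_orth_def)
  have inv12: "invertible (conj_transpose \<Psi>2 ** V12)"
    and inv21: "invertible (conj_transpose \<Psi>2 ** V21)"
    and inv11: "invertible (conj_transpose \<Phi>2 ** V11)"
    and \<Psi>1: "\<Psi>1 = V12 ** matrix_inv (conj_transpose \<Psi>2 ** V12)"
    and \<Phi>2: "\<Phi>2 = V21 ** matrix_inv (conj_transpose \<Psi>2 ** V21)"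
    and \<Phi>1: "\<Phi>1 = V11 ** matrix_inv (conj_transpose \<Phi>2 ** V11)"
    using S by auto

  have v_mem: "v ` {1..N} \<subseteq> col_space V1"
    using S pencil by (auto simp: pH_B_mult_vec pH_resolvent[OF Minv] v_def w_def)
  have w_dim: "vec.dim (w ` {1..N}) = CARD('k)"
    using span_dim by (simp add: w_def)
  have upper_v: "upper_vec ` v ` {1..N} = w ` {1..N}"
    by (simp add: image_image v_def)
  \<comment> \<open>The upper block maps the \<open>v m\<close> onto the \<open>w m\<close>, and a
    linear map cannot raise dimension.\<close>
  have "CARD('k) \<le> vec.dim (v ` {1..N})"
    using vec.dim_image_le[OF linear_upper_vec, of "v ` {1..N}"] by (simp only: upper_v w_dim)
  with v_mem have V1: "col_space V1 = vec.span (v ` {1..N})"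
    by (rule col_space_eq_span)
  have "w ` {1..N} \<subseteq> col_space V0"
    using V0_ran by (auto simp: w_def)
  then have V0_span: "col_space V0 = vec.span (w ` {1..N})"
    using w_dim by (intro col_space_eq_span) simp_all
  have V11_V0: "col_space V11 = col_space V0"
    unfolding V11_def col_space_upper_block V1 V0_span upper_v[symmetric]
    by (rule vec.linear_span_image[OF linear_upper_vec, symmetric])
  have V12_V0: "col_space (matrix_inv M ** V12) \<subseteq> col_space V0"
  proof -
    have "col_space (matrix_inv M ** V12) = vec.span ((*v) (matrix_inv M) ` lower_vec ` v ` {1..N})"
      unfolding V12_def col_space_matrix_mult col_space_lower_block V1
      by (simp add: vec.linear_span_image[OF linear_lower_vec, symmetric]
          vec.linear_span_image[OF matrix_vector_mul_linear_gen, symmetric])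
    \<comment> \<open>\<open>M\<close> cancels from the lower block of \<open>v m\<close>. A factor
      \<open>s m\<close> may be zero, so this yields only an inclusion of spans.\<close>
    also have "(*v) (matrix_inv M) ` lower_vec ` v ` {1..N} = (\<lambda>m. s m *s w m) ` {1..N}"
      by (simp add: image_image v_def vector_scalar_commute matrix_vector_mul_assoc
          matrix_inv_inverse[OF Minv])
    also have "vec.span \<dots> \<subseteq> vec.span (w ` {1..N})"
      by (intro vec.span_minimal) (auto intro: vec.span_scale vec.span_base)
    finally show ?thesis
      by (simp add: V0_span)
  qed

  \<comment> \<open>The lower block of \<open>pH_H M K ** V1\<close> is
    \<open>matrix_inv M ** V12\<close>, so the range condition linking \<open>V1\<close> and
    \<open>V2\<close> applies to it.\<close>
  have "col_space (matrix_inv M ** V12) \<subseteq> col_space V22"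
  proof -
    have "matrix_inv M ** V12 = lower_block (pH_H M K ** V1)"
      unfolding V12_def
      by (simp add: matrix_eq lower_block_mult_vec matrix_vector_mul_assoc[symmetric] pH_H_mult_vec)
    then show ?thesis
      using S by (simp add: col_space_lower_block V22_def image_mono)
  qed
  then obtain Z where "matrix_inv M ** V12 = \<Psi>2 ** Z"
    using col_space_subset_factor orth(2) by metis
  then have "M ** (matrix_inv M ** V12) = M ** (\<Psi>2 ** Z)"
    by simp
  then have V12: "V12 = M ** \<Psi>2 ** Z"
    by (simp add: matrix_mul_assoc matrix_inv_inverse[OF Minv])
  \<comment> \<open>\<open>Q\<close> will turn out to be the reduced mass matrix of the symplectic
    model.\<close>
  define Q where "Q = conj_transpose \<Psi>2 ** M ** \<Psi>2"
  have Q12: "conj_transpose \<Psi>2 ** V12 = Q ** Z"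
    by (simp add: V12 Q_def matrix_mul_assoc)
  \<comment> \<open>The invertibility assumed in the construction is that of \<open>Q ** Z\<close>.
    With \<open>Z\<close> invertible, the factorization of \<open>V12\<close> can be solved for
    \<open>\<Psi>2\<close>.\<close>
  have Zinv: "invertible Z"
    using inv12 unfolding Q12 by (rule invertible_mult_rightD)
  have Qinv: "invertible Q"
    using pos_def_congruence[OF M orth(1)] by (simp add: Q_def pos_def_invertible)
  have "\<Psi>2 = matrix_inv M ** V12 ** matrix_inv Z"
  proof -
    have "matrix_inv M ** V12 ** matrix_inv Z
        = (matrix_inv M ** M) ** \<Psi>2 ** (Z ** matrix_inv Z)"
      by (simp only: V12 matrix_mul_assoc)
    then show ?thesis
      by (simp add: matrix_inv_inverse Minv Zinv)
  qed
  then have "col_space \<Psi>2 \<subseteq> col_space V0"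
    using col_space_mult_subset V12_V0 by (metis subset_trans)
  then obtain \<Theta> where \<Theta>: "unitary \<Theta>" "\<Psi>2 = V0 ** \<Theta>"
    using orthonormal_bases_unitary[OF V0 orth(1)] by blast

  \<comment> \<open>The factor \<open>Z\<close> cancels: it occurs in \<open>V12\<close> and,
    inverted, in the normalization of \<open>\<Psi>1\<close>.\<close>
  have "\<Psi>1 = M ** \<Psi>2 ** matrix_inv Q"
  proof -
    have "(Q ** Z) ** (matrix_inv Z ** matrix_inv Q)
        = Q ** (Z ** matrix_inv Z) ** matrix_inv Q"
      by (simp only: matrix_mul_assoc)
    then have "matrix_inv (Q ** Z) = matrix_inv Z ** matrix_inv Q"
      by (intro matrix_inv_eqI) (simp add: matrix_inv_inverse Zinv Qinv)
    then have "\<Psi>1 = M ** \<Psi>2 ** (Z ** matrix_inv Z) ** matrix_inv Q"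
      unfolding \<Psi>1 Q12 by (simp add: V12 matrix_mul_assoc)
    then show ?thesis
      by (simp add: matrix_inv_inverse Zinv)
  qed
  moreover have Qher: "conj_transpose (matrix_inv Q) = matrix_inv Q"
  proof -
    have "conj_transpose Q = Q"
      by (simp add: Q_def conj_transpose_congruence Mher)
    then have "Q ** conj_transpose (matrix_inv Q) = conj_transpose (matrix_inv Q ** Q)"
      by (simp add: conj_transpose_mult)
    then have "Q ** conj_transpose (matrix_inv Q) = mat 1"
      by (simp add: matrix_inv_inverse Qinv)
    then show ?thesis
      using matrix_inv_eqI by metis
  qed
  ultimately have "conj_transpose \<Psi>1 ** matrix_inv M ** \<Psi>1
      = matrix_inv Q ** (conj_transpose \<Psi>2 ** (M ** matrix_inv M) ** M ** \<Psi>2) ** matrix_inv Q"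
    by (simp add: conj_transpose_mult Mher matrix_mul_assoc)
  also have "\<dots> = matrix_inv Q ** Q ** matrix_inv Q"
    by (simp add: matrix_inv_inverse Minv Q_def)
  also have "\<dots> = matrix_inv Q"
    by (simp add: matrix_inv_inverse Qinv)
  finally have \<Psi>1_Q: "matrix_inv (conj_transpose \<Psi>1 ** matrix_inv M ** \<Psi>1) = Q"
    by (simp add: matrix_inv_eqI matrix_inv_inverse Qinv)

  \<comment> \<open>Since \<open>\<Theta>\<close> is unitary, \<open>V11\<close> also factors
    through \<open>\<Psi>2\<close>, say as \<open>\<Psi>2 ** B\<close>.\<close>
  have "V0 = \<Psi>2 ** conj_transpose \<Theta>"
    using \<Theta> by (simp add: unitary_def matrix_mul_assoc[symmetric])
  moreover obtain A where "V11 = V0 ** A"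
    using V11_V0 col_space_subset_factor by (metis order_refl)
  ultimately obtain B where V11: "V11 = \<Psi>2 ** B"
    by (metis matrix_mul_assoc)
  \<comment> \<open>The normalization of \<open>\<Phi>2\<close> makes it biorthogonal to
    \<open>\<Psi>2\<close>. Hence \<open>\<Phi>1\<close> is \<open>\<Psi>2 ** B\<close> times the
    inverse of \<open>B\<close>.\<close>
  have "conj_transpose \<Psi>2 ** \<Phi>2 = mat 1"
    unfolding \<Phi>2 by (simp add: matrix_mul_assoc matrix_inv_inverse inv21)
  then have "conj_transpose \<Phi>2 ** \<Psi>2 = mat 1"
    by (metis conj_transpose_mult conj_transpose_conj_transpose conj_transpose_mat_1)
  then have "conj_transpose \<Phi>2 ** V11 = B"
    by (simp add: V11 matrix_mul_assoc)
  then have "\<Phi>1 = \<Psi>2"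
    using inv11 unfolding \<Phi>1
    by (simp add: V11 matrix_mul_assoc[symmetric] matrix_inv_inverse)
  then show ?thesis
    using that \<Theta> \<Psi>1_Q unfolding Q_def by blast
qed

subsection \<open>Second-order systems\<close>

text \<open>Multiplying the congruent equation by \<open>\<Theta>\<close> removes the leading
  \<open>conj_transpose \<Theta>\<close> from every term; the initial data transform the same way
  and the output is unchanged.\<close>

lemma second_order_model_unitary:
  assumes \<Theta>: "unitary \<Theta>"
    and sol: "second_order_model (conj_transpose \<Theta> ** M ** \<Theta>) (conj_transpose \<Theta> ** D ** \<Theta>)
      (conj_transpose \<Theta> ** K ** \<Theta>) (conj_transpose \<Theta> ** \<Gamma>)
      (conj_transpose \<Theta> *v z0) (conj_transpose \<Theta> *v v0) u z y"
  shows "second_order_model M D K \<Gamma> z0 v0 u (\<lambda>t. \<Theta> *v z t) y"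
proof -
  have cancel: "\<Theta> *v (conj_transpose \<Theta> *v x) = x" for x
    using \<Theta> by (simp add: unitary_def matrix_vector_mul_assoc)
  obtain z' z'' where init: "z 0 = conj_transpose \<Theta> *v z0" "z' 0 = conj_transpose \<Theta> *v v0"
    and deriv: "\<And>t. t \<ge> 0 \<Longrightarrow> (z has_vector_derivative z' t) (at t within {0..})"
      "\<And>t. t \<ge> 0 \<Longrightarrow> (z' has_vector_derivative z'' t) (at t within {0..})"
    and eqn: "\<And>t. t \<ge> 0 \<Longrightarrow> (conj_transpose \<Theta> ** M ** \<Theta>) *v z'' t
      + (conj_transpose \<Theta> ** D ** \<Theta>) *v z' t + (conj_transpose \<Theta> ** K ** \<Theta>) *v z t
      = (conj_transpose \<Theta> ** \<Gamma>) *v u t"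
    and out: "\<And>t. t \<ge> 0 \<Longrightarrow> y t = conj_transpose (conj_transpose \<Theta> ** \<Gamma>) *v z' t"
    using sol unfolding second_order_model_def by blast
  have "M *v (\<Theta> *v z'' t) + D *v (\<Theta> *v z' t) + K *v (\<Theta> *v z t) = \<Gamma> *v u t" if "t \<ge> 0" for t
  proof -
    have "\<Theta> *v (conj_transpose \<Theta> *v (M *v (\<Theta> *v z'' t) + D *v (\<Theta> *v z' t) + K *v (\<Theta> *v z t)))
        = \<Theta> *v (conj_transpose \<Theta> *v (\<Gamma> *v u t))"
      using eqn[OF that] by (simp add: matrix_vector_mul_assoc[symmetric] vec.add)
    then show ?thesis
      by (simp only: cancel)
  qed
  moreover have "y t = conj_transpose \<Gamma> *v (\<Theta> *v z' t)" if "t \<ge> 0" for t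
    using out[OF that] by (simp add: conj_transpose_mult matrix_vector_mul_assoc)
  moreover have "((\<lambda>t. \<Theta> *v z t) has_vector_derivative \<Theta> *v z' t) (at t within {0..})"
    "((\<lambda>t. \<Theta> *v z' t) has_vector_derivative \<Theta> *v z'' t) (at t within {0..})" if "t \<ge> 0" for t
    using deriv[OF that]
    by (auto intro: bounded_linear.has_vector_derivative[OF matrix_vector_mul_bounded_linear])
  ultimately show ?thesis
    unfolding second_order_model_def
    by (intro exI[of _ "\<lambda>t. \<Theta> *v z' t"] exI[of _ "\<lambda>t. \<Theta> *v z'' t"]) (simp add: init cancel)
qed

lemma second_order_homogeneous_eq_0:
  fixes M D K :: "complex^'n^'n" and w :: "real \<Rightarrow> complex^'n"
  assumes M: "pos_def M" and D: "pos_semidef D" and K: "pos_def K"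
    and init: "w 0 = 0" "w' 0 = 0"
    and deriv: "\<And>t. t \<ge> 0 \<Longrightarrow> (w has_vector_derivative w' t) (at t within {0..})"
      "\<And>t. t \<ge> 0 \<Longrightarrow> (w' has_vector_derivative w'' t) (at t within {0..})"
    and eqn: "\<And>t. t \<ge> 0 \<Longrightarrow> M *v w'' t + D *v w' t + K *v w t = 0"
    and t: "t \<ge> 0"
  shows "w t = 0"
proof -
  define E where "E t = inner (w' t) (M *v w' t) + inner (w t) (K *v w t)" for t
  have E_deriv: "(E has_vector_derivative - 2 * inner (w' t) (D *v w' t)) (at t within {0..})"
    if "t \<ge> 0" for t
  proof -
    have "(E has_vector_derivative
        (inner (w' t) (M *v w'' t) + inner (w'' t) (M *v w' t)) +
        (inner (w t) (K *v w' t) + inner (w' t) (K *v w t))) (at t within {0..})"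
      unfolding E_def using deriv[OF that]
      by (intro has_vector_derivative_add
          bounded_bilinear.has_vector_derivative[OF bounded_bilinear_inner]
          bounded_linear.has_vector_derivative[OF matrix_vector_mul_bounded_linear])
    \<comment> \<open>Symmetry of the Hermitian forms pairs everything with the velocity, so that
      the equation of motion can be substituted.\<close>
    also have "(inner (w' t) (M *v w'' t) + inner (w'' t) (M *v w' t)) +
        (inner (w t) (K *v w' t) + inner (w' t) (K *v w t))
      = 2 * inner (w' t) (M *v w'' t + K *v w t)"
      using M K by (simp add: pos_def_def inner_hermitian[of M "w'' t"] inner_hermitian[of K "w t"]
          inner_add_right)
    also have "M *v w'' t + K *v w t = - (D *v w' t)"
      using eqn[OF that] by (simp add: eq_neg_iff_add_eq_0 ac_simps)
    finally show ?thesis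
      by simp
  qed
  \<comment> \<open>At time zero the derivative is only one-sided. The open-interval criterion asks
    for two-sided derivatives at interior points and mere continuity at the ends.\<close>
  have "E t \<le> E 0"
  proof (rule DERIV_nonpos_imp_decreasing_open[OF t])
    fix x assume x: "0 < x" "x < t"
    then have "(E has_vector_derivative - 2 * inner (w' x) (D *v w' x)) (at x)"
      using E_deriv[of x] at_within_interior[of x "{0..}"] by simp
    then have "DERIV E x :> - 2 * inner (w' x) (D *v w' x)"
      by (simp only: has_real_derivative_iff_has_vector_derivative)
    moreover have "- 2 * inner (w' x) (D *v w' x) \<le> 0"
      using D by (simp add: pos_semidef_def Re_cinner)
    ultimately show "\<exists>y. DERIV E x :> y \<and> y \<le> 0"
      by blast
  next
    have "continuous_on {0..} E"
      unfolding continuous_on_eq_continuous_within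
      by (metis E_deriv atLeast_iff has_vector_derivative_continuous)
    then show "continuous_on {0..t} E"
      by (rule continuous_on_subset) auto
  qed
  then have "inner (w t) (K *v w t) \<le> 0"
    using pos_def_inner_nonneg[OF M, of "w' t"] by (simp add: E_def init)
  then show ?thesis
    using pos_def_inner_pos[OF K] by (meson not_less)
qed

text \<open>The forcing and the initial data cancel in the difference of two solutions, which
  therefore solves the homogeneous problem with zero data.\<close>

lemma second_order_model_unique:
  fixes M D K :: "complex^'n^'n"
  assumes "pos_def M" "pos_semidef D" "pos_def K"
    and z: "second_order_model M D K \<Gamma> z0 v0 u z y"
    and q: "second_order_model M D K \<Gamma> z0 v0 u q r"
    and "t \<ge> 0"
  shows "z t = q t"
proof -
  obtain z' z'' where z: "z 0 = z0" "z' 0 = v0"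
    "\<And>t. t \<ge> 0 \<Longrightarrow> (z has_vector_derivative z' t) (at t within {0..})"
    "\<And>t. t \<ge> 0 \<Longrightarrow> (z' has_vector_derivative z'' t) (at t within {0..})"
    "\<And>t. t \<ge> 0 \<Longrightarrow> M *v z'' t + D *v z' t + K *v z t = \<Gamma> *v u t"
    using z unfolding second_order_model_def by blast
  obtain q' q'' where q: "q 0 = z0" "q' 0 = v0"
    "\<And>t. t \<ge> 0 \<Longrightarrow> (q has_vector_derivative q' t) (at t within {0..})"
    "\<And>t. t \<ge> 0 \<Longrightarrow> (q' has_vector_derivative q'' t) (at t within {0..})"
    "\<And>t. t \<ge> 0 \<Longrightarrow> M *v q'' t + D *v q' t + K *v q t = \<Gamma> *v u t"
    using q unfolding second_order_model_def by blast
  have eqn: "M *v (z'' t - q'' t) + D *v (z' t - q' t) + K *v (z t - q t) = 0" if "t \<ge> 0" for t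
  proof -
    have eqn: "M *v (z'' t - q'' t) + D *v (z' t - q' t) + K *v (z t - q t)
        = (M *v z'' t + D *v z' t + K *v z t) - (M *v q'' t + D *v q' t + K *v q t)"
      by (simp add: vec.diff)
    then show ?thesis
      using z(5) q(5) that by simp
  qed
  have "z t - q t = 0"
  proof (rule second_order_homogeneous_eq_0[OF assms(1-3) _ _ _ _ eqn \<open>t \<ge> 0\<close>])
    show "z 0 - q 0 = 0" "z' 0 - q' 0 = 0"
      by (simp_all add: z(1,2) q(1,2))
  qed (intro has_vector_derivative_diff z(3,4) q(3,4); assumption)+
  then show ?thesis
    by simp
qed

text \<open>The hypothesis \<open>span_dim\<close> says that the interpolation vectors fill the
  whole reduced dimension, which forces both models onto the same subspace. Initial velocities are
  projections of a common \<open>v0\<close>, and \<open>\<Theta>\<close> is fixed before the initial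
  data and the input.\<close>

theorem theorem7:
  fixes M D K :: "complex^'n^'n"
    and \<Gamma> :: "complex^'p^'n"
    and N :: nat
    and s :: "nat \<Rightarrow> complex"
    and \<mu> :: "nat \<Rightarrow> complex^'p"
    and V0 :: "complex^'k^'n"
    and V1 V2 :: "complex^'k^('n + 'n)"
    and \<Psi>1 \<Psi>2 \<Phi>1 \<Phi>2 :: "complex^'k^'n"
  assumes k_le_n: "CARD('k) \<le> CARD('n)"
    and M: "pos_def M" and K: "pos_def K" and D: "pos_semidef D"
    and pencil: "\<forall>m\<in>{1..N}. invertible (quad_pencil M D K (s m))"
    and span_dim: "vec.dim ((\<lambda>m. matrix_inv (quad_pencil M D K (s m)) *v (\<Gamma> *v \<mu> m)) ` {1..N}) = CARD('k)"
    and V0_orthonormal: "conj_transpose V0 ** V0 = mat 1"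
    and V0_ran: "\<forall>m\<in>{1..N}. matrix_inv (quad_pencil M D K (s m)) *v (\<Gamma> *v \<mu> m) \<in> col_space V0"
    and symplectic: "symplectic_pH_construction M D K \<Gamma> N s \<mu> V1 V2 \<Psi>1 \<Psi>2 \<Phi>1 \<Phi>2"
  shows "\<exists>\<Theta> :: complex^'k^'k. unitary \<Theta> \<and>
    (\<forall>(z0 :: complex^'n) (v0 :: complex^'n) (u :: real \<Rightarrow> complex^'p) z_red y_red z_hat y_hat.
       second_order_model
         (conj_transpose V0 ** M ** V0)
         (conj_transpose V0 ** D ** V0)
         (conj_transpose V0 ** K ** V0)
         (conj_transpose V0 ** \<Gamma>)
         (conj_transpose V0 *v z0) (conj_transpose V0 *v v0) u z_red y_red \<and>
       second_order_model
         (matrix_inv (conj_transpose \<Psi>1 ** matrix_inv M ** \<Psi>1))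
         (conj_transpose \<Psi>2 ** D ** \<Psi>2)
         (conj_transpose \<Phi>1 ** K ** \<Phi>1)
         (conj_transpose \<Psi>2 ** \<Gamma>)
         (conj_transpose \<Psi>2 *v z0) (conj_transpose \<Psi>2 *v v0) u z_hat y_hat
       \<longrightarrow> (\<forall>t\<ge>0. z_red t = \<Theta> *v z_hat t))"
proof -
  obtain \<Theta> where \<Theta>: "unitary \<Theta>" "\<Psi>2 = V0 ** \<Theta>" "\<Phi>1 = \<Psi>2"
    and M_hat: "matrix_inv (conj_transpose \<Psi>1 ** matrix_inv M ** \<Psi>1) = conj_transpose \<Psi>2 ** M ** \<Psi>2"
    using symplectic_pH_reduction[OF M pencil span_dim V0_orthonormal V0_ran symplectic] by blast
  have congr: "conj_transpose \<Psi>2 ** A ** \<Psi>2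
      = conj_transpose \<Theta> ** (conj_transpose V0 ** A ** V0) ** \<Theta>" for A
    by (simp add: \<Theta>(2) conj_transpose_mult matrix_mul_assoc)
  have input: "conj_transpose \<Psi>2 ** \<Gamma> = conj_transpose \<Theta> ** (conj_transpose V0 ** \<Gamma>)"
    "conj_transpose \<Psi>2 *v z = conj_transpose \<Theta> *v (conj_transpose V0 *v z)" for z
    by (simp_all add: \<Theta>(2) conj_transpose_mult matrix_mul_assoc matrix_vector_mul_assoc)
  \<comment> \<open>Uniqueness is applied to the Arnoldi model, whose coefficients inherit
    definiteness by congruence with \<open>V0\<close>.\<close>
  note pos = pos_def_congruence[OF M V0_orthonormal] pos_semidef_congruence[OF D, of V0]
    pos_def_congruence[OF K V0_orthonormal]
  show ?thesis
    \<comment> \<open>After rewriting, the symplectic model is the \<open>\<Theta>\<close>-congruent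
      Arnoldi model, so \<open>\<Theta> *v z_hat t\<close> solves the same initial value problem as
      \<open>z_red\<close>.\<close>
    unfolding M_hat \<Theta>(3) congr input
    using \<Theta>(1) second_order_model_unique[OF pos] second_order_model_unitary by blast
qed

end
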